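(* A finite family of patterns $\mathcal F$ has the max-induced Erdős–Hajnal property if and only if $\mathcal F$ contains a $132$-avoiding permutation pattern and a $231$-avoiding permutation pattern (these two may coincide).
   Context: Sequences are finite sequences with entries in a totally ordered set (e.g. the reals); entries may repeat. A sequence $(a_1,\dots,a_m)$ is monotonic if $a_1\le a_2\le\dots\le a_m$ or $a_1\ge a_2\ge\dots\ge a_m$. Two sequences $(a_1,\dots,a_t)$ and $(b_1,\dots,b_t)$ have the same pattern if for all $1\le i<j\le t$ we have $a_i>a_j$, $a_i=a_j$, $a_i<a_j$ if and only if $b_i>b_j$, $b_i=b_j$, $b_i<b_j$ respectively; a pattern is an equivalence class of (nonempty) sequences under this relation. A permutation pattern is a pattern whose class contains a permutation of $\{1,\dots,t\}$ for some $t$. A sequence (or pattern) contains the pattern $P$ if some subsequence of it (not necessarily of consecutive entries) has pattern $P$; otherwise it avoids $P$. A subsequence $(a_{i_1},\dots,a_{i_t})$, $i_1<\dots<i_t$, of $(a_1,\dots,a_m)$ is max-induced if for every $1\le j<t$ the maximum of $a_{i_j},a_{i_j+1},\dots,a_{i_{j+1}}$ is attained at $a_{i_j}$ or at $a_{i_{j+1}}$. A family $\mathcal F$ of patterns has the max-induced Erdős–Hajnal property if there is an exponent $c=c(\mathcal F)>0$ such that every sequence $S$ having no max-induced subsequence whose pattern belongs to $\mathcal F$ has a monotonic max-induced subsequence of length at least $|S|^{c}$, where $|S|$ is the length of $S$. *)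

theory Defs
  imports Complex_Main "HOL-Library.Sublist"
begin

text \<open>Sequences are lists over a linear order, with positions counted from 0.\<close>

definition monotonic :: "'a::linorder list \<Rightarrow> bool" where
  "monotonic xs \<longleftrightarrow> sorted_wrt (\<le>) xs \<or> sorted_wrt (\<ge>) xs"

text \<open>The two sequences may live in different linear orders, so that a sequence can be compared
  with a permutation of \<open>{1..t}\<close>, written as a list of natural numbers.\<close>

definition same_pattern :: "'a::linorder list \<Rightarrow> 'b::linorder list \<Rightarrow> bool" where
  "same_pattern xs ys \<longleftrightarrow> length xs = length ys \<and>
     (\<forall>i j. i < j \<and> j < length xs \<longrightarrow>
        (xs ! i > xs ! j \<longleftrightarrow> ys ! i > ys ! j) \<and>
        (xs ! i = xs ! j \<longleftrightarrow> ys ! i = ys ! j) \<and>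
        (xs ! i < xs ! j \<longleftrightarrow> ys ! i < ys ! j))"

definition same_pattern_rel :: "('a::linorder list \<times> 'a list) set" where
  "same_pattern_rel = {(xs, ys). xs \<noteq> [] \<and> ys \<noteq> [] \<and> same_pattern xs ys}"

lemma equiv_same_pattern_rel: "equiv {xs. xs \<noteq> []} same_pattern_rel"
  by (rule equivI) (auto simp: same_pattern_rel_def same_pattern_def refl_on_def sym_def trans_def)

definition patterns :: "'a::linorder list set set" where
  "patterns = {xs. xs \<noteq> []} // same_pattern_rel"

text \<open>The pattern written as a word such as \<open>132\<close>; over an infinite order it is never empty.\<close>

definition pattern_of_word :: "nat list \<Rightarrow> 'a::linorder list set" where
  "pattern_of_word w = {xs. same_pattern xs w}"

definition permutation_pattern :: "'a::linorder list set \<Rightarrow> bool" where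
  "permutation_pattern P \<longleftrightarrow> P \<in> patterns \<and>
     (\<exists>t. \<exists>p :: nat list. distinct p \<and> set p = {1..t} \<and> (\<exists>xs\<in>P. same_pattern xs p))"

definition seq_contains :: "'a::linorder list \<Rightarrow> 'a list set \<Rightarrow> bool" where
  "seq_contains xs P \<longleftrightarrow> (\<exists>ys. subseq ys xs \<and> ys \<in> P)"

text \<open>All representatives of a pattern contain the same patterns.\<close>

definition pattern_avoids :: "'a::linorder list set \<Rightarrow> 'a list set \<Rightarrow> bool" where
  "pattern_avoids Q P \<longleftrightarrow> \<not> (\<exists>xs\<in>Q. seq_contains xs P)"

text \<open>\<open>js\<close> lists the positions of the chosen entries.\<close>

definition max_induced_subseq :: "'a::linorder list \<Rightarrow> 'a list \<Rightarrow> bool" where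
  "max_induced_subseq ys xs \<longleftrightarrow>
     (\<exists>js. sorted_wrt (<) js \<and> set js \<subseteq> {..<length xs} \<and> ys = map ((!) xs) js \<and>
        (\<forall>j. Suc j < length js \<longrightarrow>
           Max ((!) xs ` {js ! j..js ! Suc j}) \<in> {xs ! (js ! j), xs ! (js ! Suc j)}))"

definition max_induced_EH :: "'a::linorder list set set \<Rightarrow> bool" where
  "max_induced_EH F \<longleftrightarrow>
     (\<exists>c::real. c > 0 \<and>
        (\<forall>S. (\<forall>ys. max_induced_subseq ys S \<longrightarrow> (\<forall>P\<in>F. ys \<notin> P)) \<longrightarrow>
           (\<exists>ys. max_induced_subseq ys S \<and> monotonic ys \<and>
                 real (length ys) \<ge> real (length S) powr c)))"

end

(*
  Necessity: label the complete binary tree of depth n so that at every node the two subtrees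
  occupy separated ranges of values, always in the same order. Read in order this is a 132-avoiding
  (or 231-avoiding) permutation of length 2^n - 1. A monotonic max-induced subsequence runs down a
  root-to-leaf path, so it has length at most n, and every pattern found is a permutation pattern
  avoiding 132 (resp. 231).

  Sufficiency: a sequence whose monotonic max-induced subsequences have length at most k, but which
  is longer than a suitable power of k, has a max-induced subsequence whose tree of successive
  maxima is a complete binary tree of large constant depth. Cutting the two subtrees of a node at a
  threshold value makes them separated at the cost of halving the depth, and a Ramsey argument makes
  the order of separation the same at every node; such a sequence contains every short 132-avoiding
  permutation or every short 231-avoiding permutation.
*)

theory Submission
  imports Defs "HOL-Real_Asymp.Real_Asymp"
begin

section \<open>Max-induced subsequences as paths\<close>

text \<open>\<open>max_path y ys xs\<close>: in the sequence \<open>y # xs\<close> the subsequence \<open>y # ys\<close> starting at the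
  first entry is max-induced.\<close>

inductive max_path :: "'a::linorder \<Rightarrow> 'a list \<Rightarrow> 'a list \<Rightarrow> bool" where
  Nil: "max_path y [] xs"
| skip: "x \<le> max y z \<Longrightarrow> max_path y (z # zs) xs \<Longrightarrow> max_path y (z # zs) (x # xs)"
| take: "max_path z zs xs \<Longrightarrow> max_path y (z # zs) (z # xs)"

inductive_cases max_path_NilE: "max_path y ys []"

lemma max_path_ConsE [consumes 1, case_names Nil skip take]:
  assumes "max_path y ys (x # xs)"
  obtains "ys = []"
  | z zs where "ys = z # zs" "x \<le> max y z" "max_path y (z # zs) xs"
  | zs where "ys = x # zs" "max_path x zs xs"
  using assms by cases auto

lemma max_path_skips:
  "\<forall>v\<in>set V. v \<le> max y z \<Longrightarrow> max_path z zs W \<Longrightarrow> max_path y (z # zs) (V @ z # W)"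
  by (induction V) (auto intro: max_path.intros)

text \<open>Merges the rules for single entries into one jump: \<open>V\<close> is the stretch
  skipped before the next chosen entry \<open>z\<close>, and from there the path restarts with
  \<open>z\<close> in the role of \<open>y\<close>.\<close>

lemma max_path_Cons_iff:
  "max_path y (z # zs) xs \<longleftrightarrow>
    (\<exists>V W. xs = V @ z # W \<and> (\<forall>v\<in>set V. v \<le> max y z) \<and> max_path z zs W)" (is "?L \<longleftrightarrow> ?R")
proof
  show "?L \<Longrightarrow> ?R"
  proof (induction xs)
    case Nil
    then show ?case by (auto elim: max_path_NilE)
  next
    case (Cons x xs)
    from Cons.prems show ?case
    proof (cases rule: max_path_ConsE)
      case (skip z' zs')
      with Cons.IH obtain V W
        where "xs = V @ z # W" "\<forall>v\<in>set V. v \<le> max y z" "max_path z zs W"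
        by auto
      with skip show ?thesis by (intro exI[of _ "x # V"] exI[of _ W]) auto
    next
      case (take zs')
      then show ?thesis by (intro exI[of _ "[]"] exI[of _ xs]) auto
    qed auto
  qed
qed (auto intro: max_path_skips)

text \<open>The anchor \<open>y\<close> matters only for entries skipped before the first chosen
  one; if the anchor bounds all of \<open>xs\<close>, that condition holds automatically.\<close>

lemma max_path_anchor:
  "max_path y ys xs \<Longrightarrow> \<forall>x\<in>set xs. x \<le> u \<Longrightarrow> max_path u ys xs"
  by (induction rule: max_path.induct) (auto intro!: max_path.intros simp: max_def)

lemma max_path_append1: "max_path y ys xs \<Longrightarrow> max_path y ys (xs @ zs)"
  by (induction rule: max_path.induct) (auto intro: max_path.intros)

lemma max_path_append2:
  assumes "max_path y ys xs" "\<forall>x\<in>set us. x \<le> y"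
  shows "max_path y ys (us @ xs)"
  using assms(2)
proof (induction us)
  case Nil
  then show ?case using assms(1) by simp
next
  case (Cons u us)
  then show ?case by (cases ys) (auto intro!: max_path.intros simp: max_def)
qed

lemma max_path_subseq: "max_path y ys xs \<Longrightarrow> subseq ys xs"
  by (induction rule: max_path.induct) (auto dest: subseq_Cons')

text \<open>Entries skipped before the first entry of \<open>ys\<close> are bounded only by
  \<open>u\<close> or that entry. The second path bounds that entry by \<open>max y (hd zs)\<close>,
  and the third hypothesis does the same for \<open>u\<close>. When an entry of \<open>ys\<close> is
  passed it becomes the new \<open>u\<close>, and the hypothesis renews itself.\<close>

lemma max_path_trans:
  assumes "max_path u ys xs" "max_path y zs ys" "zs \<noteq> [] \<Longrightarrow> u \<le> max y (hd zs)"
  shows "max_path y zs xs"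
  using assms
proof (induction arbitrary: y zs rule: max_path.induct)
  case (Nil u xs)
  then show ?case by (auto elim: max_path_NilE intro: max_path.Nil)
next
  case (skip x u z ys xs)
  show ?case
  proof (cases zs)
    case (Cons w ws)
    have "z \<le> max y w"
      using skip.prems(1) by (cases rule: max_path_ConsE) (auto simp: Cons)
    moreover have "u \<le> max y w" using skip.prems(2) Cons by auto
    ultimately have "x \<le> max y w" using skip.hyps(1)
      by (auto simp: le_max_iff_disj)
    then show ?thesis using skip.IH[OF skip.prems] Cons by (auto intro: max_path.skip)
  qed (auto intro: max_path.Nil)
next
  case (take z ys xs u)
  note IH = take.IH
  from take.prems(1) show ?case
  proof (cases rule: max_path_ConsE)
    case (skip w ws)
    then show ?thesis using IH[of y zs] by (auto intro: max_path.skip)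
  next
    case (take ws)
    then show ?thesis using IH[of z ws]
      by (auto intro: max_path.take)
  qed (auto intro: max_path.Nil)
qed

lemma max_path_join:
  "max_path y ys A \<Longrightarrow> \<forall>a\<in>set A. a \<le> x \<Longrightarrow> max_path x zs B \<Longrightarrow> max_path y (ys @ x # zs) (A @ x # B)"
proof (induction rule: max_path.induct)
  case (Nil y A)
  then show ?case by (auto intro!: max_path_skips simp: le_max_iff_disj)
qed (auto intro: max_path.intros)

text \<open>Jumping over \<open>x\<close> would need an endpoint at least as large as
  \<open>x\<close>, but \<open>x\<close> exceeds all other entries and \<open>y\<close>. So a path
  that goes beyond \<open>A\<close> must take \<open>x\<close>.\<close>

lemma max_path_split:
  assumes "max_path y ys (A @ x # B)" "y < x" "\<forall>a\<in>set A. a < x" "\<forall>b\<in>set B. b < x"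
  shows "max_path y ys A \<or> (\<exists>yA yB. ys = yA @ x # yB \<and> max_path y yA A \<and> max_path x yB B)"
  using assms
proof (induction A arbitrary: y ys)
  case Nil
  from Nil.prems(1)[simplified] show ?case
  proof (cases rule: max_path_ConsE)
    case (skip z zs)
    then have "z \<in> set B" by (auto simp: max_path_Cons_iff)
    with skip Nil.prems show ?thesis by (auto simp: max_def split: if_splits)
  qed (auto intro: max_path.Nil)
next
  case (Cons a A)
  from Cons.prems(1)[simplified] show ?case
  proof (cases rule: max_path_ConsE)
    case Nil
    then show ?thesis by (auto intro: max_path.Nil)
  next
    case (skip z zs)
    from Cons.IH[of y ys] skip Cons.prems consider "max_path y ys A"
      | yA yB where "ys = yA @ x # yB" "max_path y yA A" "max_path x yB B"
      by auto
    then show ?thesis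
    proof cases
      case 1
      with skip show ?thesis by (auto intro: max_path.skip)
    next
      case 2
      show ?thesis
      proof (cases yA)
        case Nil
        with 2 skip have "ys = [] @ x # yB" by simp
        with 2 show ?thesis using max_path.Nil by blast
      next
        case (Cons w ws)
        with 2 skip have "max_path y yA (a # A)" by (auto intro: max_path.skip)
        with 2 show ?thesis by blast
      qed
    qed
  next
    case (take zs)
    from Cons.IH[of a zs] take Cons.prems consider "max_path a zs A"
      | yA yB where "zs = yA @ x # yB" "max_path a yA A" "max_path x yB B"
      by auto
    then show ?thesis
    proof cases
      case 1
      with take show ?thesis by (auto intro: max_path.take)
    next
      case 2
      with take have "ys = (a # yA) @ x # yB" "max_path y (a # yA) (a # A)"
        by (auto intro: max_path.take)
      with 2 show ?thesis by blast
    qed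
  qed
qed

section \<open>Agreement of the definition by positions with the inductive one\<close>

definition visible :: "'a::linorder list \<Rightarrow> nat \<Rightarrow> nat \<Rightarrow> bool" where
  "visible xs i j \<longleftrightarrow> i < j \<and> (\<forall>p. i \<le> p \<and> p \<le> j \<longrightarrow> xs ! p \<le> max (xs ! i) (xs ! j))"

lemma visible_iff_Max:
  assumes "i < j"
  shows "visible xs i j \<longleftrightarrow> Max ((!) xs ` {i..j}) \<in> {xs ! i, xs ! j}"
proof -
  let ?S = "(!) xs ` {i..j}"
  have S: "finite ?S" "xs ! i \<in> ?S" "xs ! j \<in> ?S" using assms by auto
  then have "xs ! i \<le> Max ?S" "xs ! j \<le> Max ?S" by auto
  moreover have "visible xs i j \<longleftrightarrow> (\<forall>s\<in>?S. s \<le> max (xs ! i) (xs ! j))"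
    using assms by (auto simp: visible_def)
  moreover have "\<dots> \<longleftrightarrow> Max ?S \<le> max (xs ! i) (xs ! j)"
    using S by (subst Max_le_iff) auto
  ultimately show ?thesis by (auto simp: max_def split: if_splits)
qed

text \<open>Since \<open><\<close> is transitive, sortedness of \<open>js\<close> is a condition on
  neighbours only, and \<open>visible\<close> absorbs it through its conjunct
  \<open>i < j\<close>.\<close>

lemma max_induced_iff_visible:
  "max_induced_subseq ys xs \<longleftrightarrow>
    (\<exists>js. successively (visible xs) js \<and> set js \<subseteq> {..<length xs} \<and> ys = map ((!) xs) js)"
proof -
  have "sorted_wrt (<) js \<and> (\<forall>j. Suc j < length js \<longrightarrow>
      Max ((!) xs ` {js ! j..js ! Suc j}) \<in> {xs ! (js ! j), xs ! (js ! Suc j)})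
    \<longleftrightarrow> successively (visible xs) js" for js
  proof -
    have "sorted_wrt (<) js \<longleftrightarrow> (\<forall>j. Suc j < length js \<longrightarrow> js ! j < js ! Suc j)"
      by (simp add: successively_conv_sorted_wrt[symmetric] successively_conv_nth)
    moreover have "successively (visible xs) js \<longleftrightarrow>
        (\<forall>j. Suc j < length js \<longrightarrow> js ! j < js ! Suc j \<and> visible xs (js ! j) (js ! Suc j))"
      by (auto simp: successively_conv_nth visible_def)
    ultimately show ?thesis using visible_iff_Max by blast
  qed
  then show ?thesis unfolding max_induced_subseq_def by blast
qed

text \<open>Induction on \<open>ys\<close>: the jump to \<open>z\<close> described by
  \<open>max_path_Cons_iff\<close> corresponds to a position \<open>j\<close> holding
  \<open>z\<close>, with \<open>V\<close> the entries strictly between \<open>i\<close> and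
  \<open>j\<close>.\<close>

lemma max_path_drop_iff:
  assumes "i < length xs"
  shows "max_path (xs ! i) ys (drop (Suc i) xs) \<longleftrightarrow>
    (\<exists>js. successively (visible xs) (i # js) \<and> set js \<subseteq> {..<length xs} \<and> ys = map ((!) xs) js)"
  using assms
proof (induction ys arbitrary: i)
  case Nil
  then show ?case by (auto intro: max_path.Nil)
next
  case (Cons z zs)
  have "max_path (xs ! i) (z # zs) (drop (Suc i) xs) \<longleftrightarrow>
      (\<exists>j<length xs. visible xs i j \<and> xs ! j = z \<and> max_path z zs (drop (Suc j) xs))" (is "?L \<longleftrightarrow> ?R")
  proof
    assume ?L
    then obtain V W where VW: "drop (Suc i) xs = V @ z # W"
      "\<forall>v\<in>set V. v \<le> max (xs ! i) z" "max_path z zs W"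
      by (auto simp: max_path_Cons_iff)
    define U where "U = take (Suc i) xs"
    have xs: "xs = U @ V @ z # W" "length U = Suc i"
      using Cons.prems VW(1) append_take_drop_id[of "Suc i" xs] by (auto simp: U_def)
    let ?j = "Suc i + length V"
    have j: "?j < length xs" "xs ! ?j = z" using xs by (auto simp: nth_append)
    have "drop (Suc ?j) xs = W" using xs by (simp add: xs(1))
    moreover have "visible xs i ?j"
      unfolding visible_def
    proof (intro conjI allI impI)
      fix p assume p: "i \<le> p \<and> p \<le> ?j"
      consider "p = i" | "p = ?j" | "Suc i \<le> p" "p < ?j" using p by linarith
      then show "xs ! p \<le> max (xs ! i) (xs ! ?j)"
      proof cases
        case 3
        then have "xs ! p = V ! (p - Suc i)" "p - Suc i < length V"
          using xs by (auto simp: nth_append)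
        then have "xs ! p \<in> set V" by simp
        then show ?thesis using VW(2) j(2) by auto
      qed auto
    qed auto
    ultimately show ?R using j VW(3) by blast
  next
    assume ?R
    then obtain j where j: "j < length xs" "visible xs i j" "xs ! j = z"
      "max_path z zs (drop (Suc j) xs)" by blast
    let ?V = "take (j - Suc i) (drop (Suc i) xs)"
    have "drop (Suc i) xs = ?V @ drop j xs"
      using j(2) by (metis append_take_drop_id drop_drop le_add_diff_inverse2 visible_def Suc_leI)
    also have "drop j xs = z # drop (Suc j) xs" using j by (metis Cons_nth_drop_Suc)
    finally have "drop (Suc i) xs = ?V @ z # drop (Suc j) xs" .
    moreover have "\<forall>v\<in>set ?V. v \<le> max (xs ! i) z"
    proof
      fix v assume "v \<in> set ?V"
      then obtain q where q: "q < length ?V" "v = ?V ! q" by (metis in_set_conv_nth)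
      then have "v = xs ! (Suc i + q)" "Suc i + q < j" by auto
      then show "v \<le> max (xs ! i) z" using j by (auto simp: visible_def)
    qed
    ultimately show ?L using j(4) max_path_Cons_iff by blast
  qed
  also have "\<dots> \<longleftrightarrow> (\<exists>j<length xs. visible xs i j \<and> xs ! j = z \<and> (\<exists>js.
      successively (visible xs) (j # js) \<and> set js \<subseteq> {..<length xs} \<and> zs = map ((!) xs) js))"
    using Cons.IH by blast
  also have "\<dots> \<longleftrightarrow> (\<exists>js. successively (visible xs) (i # js) \<and> set js \<subseteq> {..<length xs}
      \<and> z # zs = map ((!) xs) js)" (is "?L \<longleftrightarrow> ?R")
  proof
    assume ?L
    then obtain j js where "j < length xs" "visible xs i j" "xs ! j = z"
      "successively (visible xs) (j # js)" "set js \<subseteq> {..<length xs}" "zs = map ((!) xs) js"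
      by blast
    then show ?R by (intro exI[of _ "j # js"]) auto
  next
    assume ?R
    then obtain js where js: "successively (visible xs) (i # js)" "set js \<subseteq> {..<length xs}"
      "z # zs = map ((!) xs) js" by (elim exE conjE)
    then obtain j ks where "js = j # ks" by (cases js) auto
    with js show ?L by (intro exI[of _ j]) auto
  qed
  finally show ?case .
qed

theorem max_induced_iff_max_path: "max_induced_subseq ys xs \<longleftrightarrow> (\<exists>y. max_path y ys xs)"
proof (cases ys)
  case Nil
  then show ?thesis by (auto simp: max_induced_iff_visible intro: max_path.Nil)
next
  case (Cons z zs)
  have "max_induced_subseq ys xs \<longleftrightarrow> (\<exists>i<length xs. xs ! i = z \<and> (\<exists>js.
      successively (visible xs) (i # js) \<and> set js \<subseteq> {..<length xs} \<and> zs = map ((!) xs) js))"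
    (is "?L \<longleftrightarrow> ?R")
  proof
    assume ?L
    then obtain js where js: "successively (visible xs) js" "set js \<subseteq> {..<length xs}"
      "z # zs = map ((!) xs) js" by (auto simp: max_induced_iff_visible Cons)
    then obtain i ks where "js = i # ks" by (cases js) auto
    with js show ?R by (intro exI[of _ i]) auto
  next
    assume ?R
    then obtain i js where "i < length xs" "xs ! i = z"
      "successively (visible xs) (i # js)" "set js \<subseteq> {..<length xs}" "zs = map ((!) xs) js"
      by blast
    then show ?L unfolding max_induced_iff_visible Cons by (intro exI[of _ "i # js"]) auto
  qed
  also have "\<dots> \<longleftrightarrow> (\<exists>i<length xs. xs ! i = z \<and> max_path z zs (drop (Suc i) xs))"
    using max_path_drop_iff by blast
  also have "\<dots> \<longleftrightarrow> (\<exists>y. max_path y ys xs)" (is "?L \<longleftrightarrow> ?R")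
  proof
    assume ?L
    then obtain i where i: "i < length xs" "xs ! i = z" "max_path z zs (drop (Suc i) xs)" by blast
    then have xs: "xs = take i xs @ z # drop (Suc i) xs" by (metis id_take_nth_drop)
    \<comment> \<open>With the overall maximum as anchor, everything before the first chosen
      position may be skipped.\<close>
    have "\<forall>x\<in>set (take i xs). x \<le> Max (set xs)" using in_set_takeD by fastforce
    then have "max_path (Max (set xs)) ys (take i xs @ z # drop (Suc i) xs)"
      using i(3) unfolding Cons by (intro max_path_append2 max_path.take)
    with xs show ?R by auto
  next
    assume ?R
    then obtain V W where "xs = V @ z # W" "max_path z zs W"
      by (auto simp: Cons max_path_Cons_iff)
    then show ?L by (intro exI[of _ "length V"]) auto
  qed
  finally show ?thesis .
qed

section \<open>Closure properties of max-induced subsequences\<close>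

lemma max_induced_anchor:
  "max_induced_subseq ys xs \<Longrightarrow> \<forall>x\<in>set xs. x \<le> u \<Longrightarrow> max_path u ys xs"
  using max_induced_iff_max_path max_path_anchor by blast

lemma max_induced_Nil: "max_induced_subseq [] xs"
  using max_induced_iff_max_path max_path.Nil by blast

lemma max_induced_subseq_subseq: "max_induced_subseq ys xs \<Longrightarrow> subseq ys xs"
  using max_induced_iff_max_path max_path_subseq by blast

lemma max_induced_trans:
  assumes "max_induced_subseq zs ys" "max_induced_subseq ys xs"
  shows "max_induced_subseq zs xs"
proof -
  obtain u where u: "max_path u ys xs" using assms(2) max_induced_iff_max_path by blast
  \<comment> \<open>Bounding \<open>ys\<close> makes \<open>y\<close> a valid anchor for
    \<open>zs\<close>; bounding \<open>u\<close> gives the side condition of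
    \<open>max_path_trans\<close>.\<close>
  define y where "y = Max (insert u (set ys))"
  have "\<forall>x\<in>set ys. x \<le> y" "u \<le> y" by (auto simp: y_def)
  then have "max_path y zs xs"
    using u max_induced_anchor[OF assms(1)] by (intro max_path_trans[OF u]) (auto simp: le_max_iff_disj)
  then show ?thesis using max_induced_iff_max_path by blast
qed

text \<open>As a bound of \<open>A\<close>, \<open>x\<close> can be reached over whatever is left of
  \<open>A\<close> after \<open>ys\<close>; as a bound of \<open>B\<close>, it is an anchor for
  \<open>zs\<close>.\<close>

lemma max_induced_join:
  assumes "max_induced_subseq ys A" "max_induced_subseq zs B"
    and "\<forall>a\<in>set A. a \<le> x" "\<forall>b\<in>set B. b \<le> x"
  shows "max_induced_subseq (ys @ x # zs) (A @ x # B)"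
  using assms max_path_join max_induced_anchor max_induced_iff_max_path by metis

lemma max_induced_infix:
  assumes "max_induced_subseq ys xs"
  shows "max_induced_subseq ys (us @ xs @ vs)"
proof -
  \<comment> \<open>The entries of \<open>us\<close> are skipped before the first choice, so the
    anchor must dominate them; \<open>vs\<close> comes after the last choice and is
    unconstrained.\<close>
  define y where "y = Max (set (us @ xs))"
  have "\<forall>x\<in>set us. x \<le> y" "\<forall>x\<in>set xs. x \<le> y" by (auto simp: y_def)
  then have "max_path y ys (us @ xs @ vs)"
    using max_induced_anchor[OF assms] by (intro max_path_append2 max_path_append1)
  then show ?thesis using max_induced_iff_max_path by blast
qed

lemma max_induced_refl: "max_induced_subseq xs xs"
proof -
  have "max_path y xs xs" for y
    by (induction xs arbitrary: y) (auto intro: max_path.intros)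
  then show ?thesis using max_induced_iff_max_path by blast
qed

text \<open>Case distinction on the first chosen entry: in \<open>B\<close>, equal to the occurrence
  \<open>x\<close>, or in \<open>A\<close>. In the last case \<open>max_path_split\<close> applies
  with that entry as anchor.\<close>

lemma max_induced_split:
  assumes "max_induced_subseq ys (A @ x # B)" "\<forall>a\<in>set A. a < x" "\<forall>b\<in>set B. b < x"
  shows "max_induced_subseq ys A \<or> max_induced_subseq ys B \<or>
    (\<exists>yA yB. ys = yA @ x # yB \<and> max_induced_subseq yA A \<and> max_induced_subseq yB B)"
proof (cases ys)
  case Nil
  then show ?thesis by (simp add: max_induced_Nil)
next
  case (Cons z zs)
  obtain V W where VW: "A @ x # B = V @ z # W" "max_path z zs W"
    using assms(1) by (auto simp: max_induced_iff_max_path max_path_Cons_iff Cons)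
  from VW(1) obtain us where "A = V @ us \<and> us @ x # B = z # W \<or> A @ us = V \<and> x # B = us @ z # W"
    by (auto simp: append_eq_append_conv2)
  then consider us where "V = A @ x # us" "B = us @ z # W" | "V = A" "z = x" "W = B"
    | us where "A = V @ z # us" "W = us @ x # B"
    by (cases us) auto
  then show ?thesis
  proof cases
    case 1
    have "max_induced_subseq ys (z # W)"
      using VW(2) Cons max_induced_iff_max_path max_path.take by blast
    then have "max_induced_subseq ys B" using 1 max_induced_infix[of _ _ us "[]"] by simp
    then show ?thesis by simp
  next
    case 2
    then have "max_induced_subseq zs B" using VW(2) max_induced_iff_max_path by blast
    then show ?thesis using 2 Cons max_induced_Nil by (metis append_Nil)
  next
    case 3
    have lift: "max_induced_subseq (z # ws) A" if "max_path z ws us" for ws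
    proof -
      have "max_induced_subseq (z # ws) (z # us)"
        using that max_induced_iff_max_path max_path.take by blast
      then show ?thesis using 3 max_induced_infix[of _ _ V "[]"] by simp
    qed
    from max_path_split[of z zs us x B] VW(2) 3 assms
    consider "max_path z zs us"
      | yA yB where "zs = yA @ x # yB" "max_path z yA us" "max_path x yB B" by auto
    then show ?thesis
    proof cases
      case 1
      then show ?thesis using lift Cons by simp
    next
      case 2
      then have "max_induced_subseq yB B" using max_induced_iff_max_path by blast
      with 2 lift show ?thesis unfolding Cons by (metis append_Cons)
    qed
  qed
qed

text \<open>Nothing between two copies of an upper bound exceeds them. This turns a bound on
  non-increasing max-induced subsequences into one on the multiplicity of the maximum.\<close>

lemma max_induced_replicate_count:
  "\<forall>x\<in>set xs. x \<le> m \<Longrightarrow> max_induced_subseq (replicate (count_list xs m) m) xs"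
proof (induction "length xs" arbitrary: xs rule: less_induct)
  case less
  show ?case
  proof (cases "m \<in> set xs")
    case True
    then obtain A B where xs: "xs = A @ m # B" "m \<notin> set A" by (meson split_list_first)
    with less have "max_induced_subseq (replicate (count_list B m) m) B" by auto
    then have "max_induced_subseq ([] @ m # replicate (count_list B m) m) (A @ m # B)"
      using less.prems xs by (intro max_induced_join max_induced_Nil) auto
    with xs show ?thesis by (simp add: count_notin)
  qed (simp add: count_notin max_induced_Nil)
qed

lemma max_induced_set: "max_induced_subseq ys xs \<Longrightarrow> set ys \<subseteq> set xs"
  using max_induced_subseq_subseq[of ys xs] by (auto elim!: list_emb_set)

lemma max_induced_left: "max_induced_subseq A (A @ B)"
  using max_induced_infix[OF max_induced_refl, of A "[]"] by simp

lemma max_induced_right: "max_induced_subseq B (A @ x # B)"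
  using max_induced_infix[OF max_induced_refl, of B "A @ [x]" "[]"] by simp

section \<open>Branching sequences\<close>

text \<open>A complete binary tree of height \<open>h\<close> whose nodes are strict maxima. Each
  level is sought in a max-induced subsequence rather than in \<open>xs\<close> itself, which makes
  the property pass to larger sequences.\<close>

fun branching :: "nat \<Rightarrow> 'a::linorder list \<Rightarrow> bool" where
  "branching 0 xs \<longleftrightarrow> True"
| "branching (Suc h) xs \<longleftrightarrow> (\<exists>A x B. max_induced_subseq (A @ x # B) xs \<and>
     (\<forall>y\<in>set A \<union> set B. y < x) \<and> branching h A \<and> branching h B)"

lemma branching_SucI:
  assumes "\<forall>y\<in>set A \<union> set B. y < x" "branching h A" "branching h B"
  shows "branching (Suc h) (A @ x # B)"
  unfolding branching.simps using assms max_induced_refl by blast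

lemma branching_mono:
  "branching h ys \<Longrightarrow> max_induced_subseq ys xs \<Longrightarrow> branching h xs"
  by (cases h) (auto, blast intro: max_induced_trans)

lemma branching_antimono: "branching h xs \<Longrightarrow> h' \<le> h \<Longrightarrow> branching h' xs"
proof (induction h arbitrary: h' xs)
  case (Suc h)
  show ?case
  proof (cases h')
    case (Suc k)
    with Suc.prems Suc.IH show ?thesis by auto (meson Un_iff)
  qed simp
qed simp

text \<open>The copies of \<open>m\<close> cut \<open>xs\<close> into gaps. Two gaps that are both
  \<open>branching h\<close> would form a tree of height \<open>Suc h\<close> with a copy of
  \<open>m\<close> as root, so at most one gap needs the bound \<open>a\<close> and all others obey
  \<open>b\<close>. The induction peels off the first gap.\<close>

lemma length_le_of_gaps:
  assumes "\<forall>x\<in>set xs. x \<le> m"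
    and "\<And>I us vs. xs = us @ I @ vs \<Longrightarrow> \<forall>x\<in>set I. x < m \<Longrightarrow> length I \<le> a"
    and "\<And>I us vs. xs = us @ I @ vs \<Longrightarrow> \<forall>x\<in>set I. x < m \<Longrightarrow> \<not> branching h I \<Longrightarrow> length I \<le> b"
    and "\<not> branching (Suc h) xs"
  shows "length xs \<le> a + count_list xs m * (b + 1)"
  using assms
proof (induction "length xs" arbitrary: xs a rule: less_induct)
  case less
  show ?case
  proof (cases "m \<in> set xs")
    case False
    then have "\<forall>x\<in>set xs. x < m" using less.prems(1) by (metis order_le_less)
    then show ?thesis using less.prems(2)[of "[]" xs "[]"] by simp
  next
    case True
    then obtain A B where xs: "xs = A @ m # B" "m \<notin> set A" by (meson split_list_first)
    have A: "\<forall>x\<in>set A. x < m" using xs less.prems(1) by (auto simp: order_le_less)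
    have infix_B: "xs = (A @ m # us) @ I @ vs" if "B = us @ I @ vs" for us I vs
      using that xs by simp
    have "max_induced_subseq B xs" unfolding xs(1) by (rule max_induced_right)
    then have nB: "\<not> branching (Suc h) B" using less.prems(4) branching_mono by blast
    have "length B \<le> a' + count_list B m * (b + 1)"
      if "\<And>I us vs. B = us @ I @ vs \<Longrightarrow> \<forall>x\<in>set I. x < m \<Longrightarrow> length I \<le> a'" for a'
    proof (rule less.hyps)
      show "length B < length xs" "\<forall>x\<in>set B. x \<le> m" using xs less.prems(1) by auto
      show "\<not> branching (Suc h) B" by (rule nB)
      show "length I \<le> b" if "B = us @ I @ vs" "\<forall>x\<in>set I. x < m" "\<not> branching h I" for us I vs
        using less.prems(3)[OF infix_B] that by blast
    qed (use that in blast)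
    note B_bound = this
    show ?thesis
    proof (cases "branching h A")
      case True
      \<comment> \<open>The first gap is the exceptional one, so \<open>b\<close> bounds every gap
        of \<open>B\<close> and takes the place of \<open>a\<close>.\<close>
      have "length B \<le> b + count_list B m * (b + 1)"
      proof (rule B_bound)
        fix I us vs assume I: "B = us @ I @ vs" "\<forall>x\<in>set I. x < m"
        have "\<not> branching h I"
        proof
          assume "branching h I"
          have "max_induced_subseq I B" using max_induced_infix[OF max_induced_refl] I by blast
          then have "max_induced_subseq (A @ m # I) xs"
            unfolding xs(1) using less.prems(1) xs by (intro max_induced_join max_induced_refl) auto
          moreover have "branching (Suc h) (A @ m # I)"
            using A I(2) True \<open>branching h I\<close> by (intro branching_SucI) auto
          ultimately have "branching (Suc h) xs" using branching_mono by blast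
          then show False using less.prems(4) by blast
        qed
        then show "length I \<le> b" using less.prems(3)[OF infix_B] I by blast
      qed
      moreover have "length A \<le> a" using less.prems(2)[of "[]" A "m # B"] xs A by simp
      ultimately show ?thesis using xs by (simp add: count_notin)
    next
      case False
      have "length B \<le> a + count_list B m * (b + 1)"
        by (rule B_bound) (use less.prems(2)[OF infix_B] in blast)
      moreover have "length A \<le> b" using less.prems(3)[of "[]" A "m # B"] xs A False by simp
      ultimately show ?thesis using xs by (simp add: count_notin)
    qed
  qed
qed

text \<open>Induction on \<open>h\<close>, and inside it on \<open>i + j\<close>. A gap with the
  maximum \<open>m\<close> on its left allows \<open>m\<close> to be prepended to non-increasing
  subsequences, so \<open>i\<close> drops by one; with \<open>m\<close> on its right,
  \<open>m\<close> can be appended to non-decreasing ones and \<open>j\<close> drops. Gaps that are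
  not \<open>branching h\<close> fall under the outer induction.\<close>

lemma length_less_of_not_branching:
  assumes "\<not> branching h xs"
    and "\<And>ys. max_induced_subseq ys xs \<Longrightarrow> sorted_wrt (\<ge>) ys \<Longrightarrow> length ys \<le> i"
    and "\<And>ys. max_induced_subseq ys xs \<Longrightarrow> sorted_wrt (\<le>) ys \<Longrightarrow> length ys \<le> j"
  shows "length xs < (i + j + 1) ^ (2 * h)"
  using assms
proof (induction h arbitrary: xs i j)
  case (Suc h)
  note outer = Suc.IH
  from Suc.prems show ?case
  proof (induction "i + j" arbitrary: xs i j rule: less_induct)
    case less
    show ?case
    proof (cases "xs = []")
      case False
      define m where "m = Max (set xs)"
      have m: "m \<in> set xs" "\<forall>x\<in>set xs. x \<le> m" using False by (auto simp: m_def)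
      define D where "D = i + j"
      \<comment> \<open>\<open>?a\<close> comes from the inner induction, where
        \<open>i + j + 1\<close> has decreased to \<open>D\<close>; \<open>?b\<close> comes from the
        outer one with \<open>i\<close> and \<open>j\<close> unchanged.\<close>
      let ?a = "D ^ (2 * Suc h) - 1" and ?b = "(D + 1) ^ (2 * h) - 1"
      have "max_induced_subseq (replicate (count_list xs m) m) xs"
        using m by (intro max_induced_replicate_count) auto
      moreover have "sorted_wrt (\<ge>) (replicate (count_list xs m) m)"
        by (simp add: sorted_wrt_iff_nth_less)
      ultimately have count: "count_list xs m \<le> D"
        using less.prems(2) by (fastforce simp: D_def)
      have ind: "max_induced_subseq ys xs" if "xs = us @ I @ vs" "max_induced_subseq ys I"
        for ys us I vs using that max_induced_infix by blast
      have "length xs \<le> ?a + count_list xs m * (?b + 1)"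
      proof (rule length_le_of_gaps[where h = h])
        fix I us vs assume I: "xs = us @ I @ vs" "\<forall>x\<in>set I. x < m"
        { assume "\<not> branching h I"
          from outer[OF this, of i j] less.prems(2,3) ind[OF I(1)]
          have "length I < (D + 1) ^ (2 * h)" unfolding D_def by blast
          then show "length I \<le> ?b" by simp }
        have nI: "\<not> branching (Suc h) I"
          using less.prems(1) branching_mono max_induced_refl ind[OF I(1)] by blast
        have "m \<in> set us \<or> m \<in> set vs" using I m by auto
        then have "length I < D ^ (2 * Suc h)"
        proof
          assume "m \<in> set us"
          then obtain u1 u2 where us: "us = u1 @ m # u2" by (meson split_list)
          have dec: "Suc (length ys) \<le> i"
            if ys: "max_induced_subseq ys I" "sorted_wrt (\<ge>) ys" for ys
          proof -
            have "max_induced_subseq ([] @ m # ys) (u1 @ m # (u2 @ I @ vs))"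
              using m(2) I us
              by (intro max_induced_join max_induced_Nil max_induced_infix ys) auto
            then have "max_induced_subseq (m # ys) xs" using I us by simp
            moreover have "\<forall>y\<in>set ys. y \<le> m"
              using max_induced_set[OF ys(1)] I(2) by (auto dest: less_imp_le)
            ultimately show ?thesis using less.prems(2)[of "m # ys"] ys(2) by simp
          qed
          \<comment> \<open>The empty subsequence shows that \<open>i\<close> is positive, so that
            \<open>i - 1\<close> is a true predecessor.\<close>
          from dec[of "[]"] have i: "i > 0" using max_induced_Nil by force
          have "length I < (i - 1 + j + 1) ^ (2 * Suc h)"
          proof (rule less.hyps[OF _ nI])
            show "i - 1 + j < i + j" using i by simp
            show "length ys \<le> i - 1" if "max_induced_subseq ys I" "sorted_wrt (\<ge>) ys" for ys
              using dec[OF that] by simp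
            show "length ys \<le> j" if "max_induced_subseq ys I" "sorted_wrt (\<le>) ys" for ys
              using less.prems(3)[OF ind[OF I(1) that(1)] that(2)] .
          qed
          then show ?thesis using i by (simp add: D_def)
        next
          assume "m \<in> set vs"
          then obtain v1 v2 where vs: "vs = v1 @ m # v2" by (meson split_list)
          have inc: "Suc (length ys) \<le> j"
            if ys: "max_induced_subseq ys I" "sorted_wrt (\<le>) ys" for ys
          proof -
            have "max_induced_subseq (ys @ m # []) ((us @ I @ v1) @ m # v2)"
              using m(2) I vs
              by (intro max_induced_join max_induced_Nil max_induced_infix ys) auto
            then have "max_induced_subseq (ys @ [m]) xs" using I vs by simp
            moreover have "\<forall>y\<in>set ys. y \<le> m"
              using max_induced_set[OF ys(1)] I(2) by (auto dest: less_imp_le)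
            ultimately show ?thesis using less.prems(3)[of "ys @ [m]"] ys(2)
              by (simp add: sorted_wrt_append)
          qed
          from inc[of "[]"] have j: "j > 0" using max_induced_Nil by force
          have "length I < (i + (j - 1) + 1) ^ (2 * Suc h)"
          proof (rule less.hyps[OF _ nI])
            show "i + (j - 1) < i + j" using j by simp
            show "length ys \<le> i" if "max_induced_subseq ys I" "sorted_wrt (\<ge>) ys" for ys
              using less.prems(2)[OF ind[OF I(1) that(1)] that(2)] .
            show "length ys \<le> j - 1" if "max_induced_subseq ys I" "sorted_wrt (\<le>) ys" for ys
              using inc[OF that] by simp
          qed
          then show ?thesis using j by (simp add: D_def)
        qed
        then show "length I \<le> ?a" by simp
      qed (use m less.prems in auto)
      also have "\<dots> \<le> ?a + D * (D + 1) ^ (2 * h)"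
        using count by (intro add_left_mono mult_mono) auto
      \<comment> \<open>The strict step of the chain: it removes the \<open>- 1\<close> in
        \<open>?a\<close>, and \<open>D\<close> is positive because \<open>m\<close> occurs.\<close>
      also have "\<dots> < D ^ (2 * Suc h) + D * (D + 1) ^ (2 * h)"
      proof -
        have "D > 0" using count m(1) by (metis count_notin count_list_0_iff le_zero_eq neq0_conv)
        then show ?thesis by simp
      qed
      also have "\<dots> = D ^ 2 * D ^ (2 * h) + D * (D + 1) ^ (2 * h)"
        by (simp add: power_add power2_eq_square)
      also have "\<dots> \<le> D ^ 2 * (D + 1) ^ (2 * h) + D * (D + 1) ^ (2 * h)"
        by (intro add_right_mono mult_left_mono power_mono) auto
      also have "\<dots> = (D ^ 2 + D) * (D + 1) ^ (2 * h)" by (simp add: algebra_simps)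
      also have "\<dots> \<le> (D + 1) ^ 2 * (D + 1) ^ (2 * h)"
        by (intro mult_right_mono) (auto simp: power2_eq_square)
      also have "\<dots> = (i + j + 1) ^ (2 * Suc h)"
        by (simp add: D_def flip: power_add)
      finally show ?thesis .
    qed simp
  qed
qed simp

section \<open>Uniformly branching sequences\<close>

text \<open>\<open>True\<close> is the order that avoiding 132 forces on the two sides of the
  maximum of a permutation, \<open>False\<close> the order that avoiding 231 forces.\<close>

definition separated :: "bool \<Rightarrow> 'a::linorder list \<Rightarrow> 'a list \<Rightarrow> bool" where
  "separated d A B \<longleftrightarrow> (\<forall>a\<in>set A. \<forall>b\<in>set B. if d then b < a else a < b)"

fun uniform :: "bool \<Rightarrow> nat \<Rightarrow> 'a::linorder list \<Rightarrow> bool" where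
  "uniform d 0 xs \<longleftrightarrow> True"
| "uniform d (Suc h) xs \<longleftrightarrow> (\<exists>A x B. max_induced_subseq (A @ x # B) xs \<and>
     (\<forall>y\<in>set A \<union> set B. y < x) \<and> separated d A B \<and> uniform d h A \<and> uniform d h B)"

lemma uniform_mono:
  "uniform d h ys \<Longrightarrow> max_induced_subseq ys xs \<Longrightarrow> uniform d h xs"
  by (cases h) (auto, blast intro: max_induced_trans)

text \<open>\<open>U\<close> stands for an upper set of values. If the root lies outside
  \<open>U\<close>, so does the whole tree. Otherwise both subtrees are cut: one of them yields a
  tree of height \<open>b\<close> outside \<open>U\<close>, or their two parts inside
  \<open>U\<close> are joined below the root.\<close>

lemma branching_cut:
  assumes up: "\<And>x y. U x \<Longrightarrow> x \<le> y \<Longrightarrow> U y"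
    and "branching (a + b) xs"
  shows "(\<exists>zs. max_induced_subseq zs xs \<and> (\<forall>z\<in>set zs. U z) \<and> branching a zs) \<or>
    (\<exists>zs. max_induced_subseq zs xs \<and> (\<forall>z\<in>set zs. \<not> U z) \<and> branching b zs)"
  using assms(2)
proof (induction a arbitrary: xs)
  case 0
  then show ?case using max_induced_Nil by (intro disjI1 exI[of _ "[]"]) auto
next
  case (Suc a)
  then obtain A x B where AB: "max_induced_subseq (A @ x # B) xs" "\<forall>y\<in>set A \<union> set B. y < x"
    "branching (a + b) A" "branching (a + b) B" by auto
  have ind: "max_induced_subseq A xs" "max_induced_subseq B xs"
    using max_induced_trans[OF max_induced_left AB(1)]
      max_induced_trans[OF max_induced_right AB(1)] by auto
  show ?case
  proof (cases "U x")
    case True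
    consider zs where "max_induced_subseq zs A \<or> max_induced_subseq zs B"
        "\<forall>z\<in>set zs. \<not> U z" "branching b zs"
      | zA zB where "max_induced_subseq zA A" "max_induced_subseq zB B"
        "\<forall>z\<in>set zA \<union> set zB. U z" "branching a zA" "branching a zB"
      using Suc.IH[OF AB(3)] Suc.IH[OF AB(4)] by (metis Un_iff)
    then show ?thesis
    proof cases
      case 1
      then show ?thesis using ind max_induced_trans by blast
    next
      case 2
      have "max_induced_subseq (zA @ x # zB) (A @ x # B)"
        using 2 AB(2) by (intro max_induced_join) (auto intro: less_imp_le)
      then have "max_induced_subseq (zA @ x # zB) xs" using AB(1) max_induced_trans by blast
      moreover have "\<forall>y\<in>set zA \<union> set zB. y < x" using 2(1,2) AB(2) max_induced_set by blast
      then have "branching (Suc a) (zA @ x # zB)"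
        using 2 by (intro branching_SucI)
      ultimately show ?thesis using 2(3) True by (intro disjI1 exI[of _ "zA @ x # zB"]) auto
    qed
  next
    case False
    have "\<forall>z\<in>set (A @ x # B). \<not> U z" using False up AB(2) by (auto dest: less_imp_le)
    moreover have "branching (Suc a + b) (A @ x # B)"
      using AB(2-4) by (simp only: add_Suc branching_SucI)
    then have "branching b (A @ x # B)" using branching_antimono by (metis le_add2)
    ultimately show ?thesis using AB(1) by blast
  qed
qed

text \<open>The cut is made at the largest entry \<open>x\<close> of \<open>A\<close> above which,
  \<open>x\<close> included, \<open>A\<close> still has a tree of height \<open>n\<close>. If
  \<open>B\<close> has one below \<open>x\<close>, these two are separated. Otherwise
  \<open>B\<close> has one from \<open>x\<close> upwards, and by maximality of \<open>x\<close> so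
  much of \<open>A\<close> lies at or below \<open>x\<close> that a tree remains there.\<close>

lemma branching_separate:
  assumes "branching (2 * n + 1) A" "branching (2 * n + 1) B"
  shows "\<exists>d A' B'. max_induced_subseq A' A \<and> max_induced_subseq B' B \<and> separated d A' B' \<and>
    branching n A' \<and> branching n B'"
proof (cases "n = 0")
  case True
  then show ?thesis using max_induced_Nil
    by (intro exI[of _ True] exI[of _ "[]"]) (auto simp: separated_def)
next
  case False
  define P where "P U \<longleftrightarrow> (\<exists>zs. max_induced_subseq zs A \<and> (\<forall>z\<in>set zs. U z) \<and> branching n zs)"
    for U
  define X where "X = {x\<in>set A. P (\<lambda>z. x \<le> z)}"
  have "branching n A" using assms(1) branching_antimono by (metis le_add1 mult_2 add.assoc)
  moreover have "set A \<noteq> {}" using assms(1) by (auto dest: max_induced_set)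
  ultimately have "Min (set A) \<in> X"
    using max_induced_refl by (auto simp: X_def P_def intro!: exI[of _ A])
  then have X: "finite X" "X \<noteq> {}" by (auto simp: X_def)
  define x where "x = Max X"
  have "x \<in> X" using X by (auto simp: x_def)
  then obtain zs where zs: "max_induced_subseq zs A" "\<forall>z\<in>set zs. x \<le> z" "branching n zs"
    by (auto simp: X_def P_def)
  have "branching (n + n) B" using assms(2) by (rule branching_antimono) simp
  then have "(\<exists>ws. max_induced_subseq ws B \<and> (\<forall>z\<in>set ws. x \<le> z) \<and> branching n ws) \<or>
      (\<exists>ws. max_induced_subseq ws B \<and> (\<forall>z\<in>set ws. \<not> x \<le> z) \<and> branching n ws)"
    by (intro branching_cut) auto
  then consider ws where "max_induced_subseq ws B" "\<forall>z\<in>set ws. \<not> x \<le> z" "branching n ws"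
    | ws where "max_induced_subseq ws B" "\<forall>z\<in>set ws. x \<le> z" "branching n ws"
    by blast
  then show ?thesis
  proof cases
    case 1
    then have "separated True zs ws" using zs(2) by (fastforce simp: separated_def)
    then show ?thesis using zs 1 by blast
  next
    case 2
    \<comment> \<open>Otherwise the least entry of such a tree would be a larger threshold;
      \<open>n\<close> is nonzero, so the tree has an entry.\<close>
    have "\<not> P (\<lambda>z. x < z)"
    proof
      assume "P (\<lambda>z. x < z)"
      then obtain vs where vs: "max_induced_subseq vs A" "\<forall>z\<in>set vs. x < z" "branching n vs"
        by (auto simp: P_def)
      have "vs \<noteq> []" using vs(3) False by (cases n) (auto dest: max_induced_set)
      then have v: "Min (set vs) \<in> set vs" by simp
      then have "Min (set vs) \<in> X" using vs max_induced_set by (fastforce simp: X_def P_def)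
      then have "Min (set vs) \<le> x" using X by (simp add: x_def)
      then show False using v vs(2) by auto
    qed
    \<comment> \<open>The extra level in \<open>2 * n + 1\<close> pays for strictness: a tree of
      height \<open>Suc n\<close> with values at most \<open>x\<close> has a left subtree with
      values strictly below its root, hence below \<open>x\<close>.\<close>
    moreover have "branching (n + Suc n) A" using assms(1) by (simp add: mult_2)
    then have "P (\<lambda>z. x < z) \<or>
        (\<exists>vs. max_induced_subseq vs A \<and> (\<forall>z\<in>set vs. \<not> x < z) \<and> branching (Suc n) vs)"
      unfolding P_def by (intro branching_cut) auto
    ultimately obtain vs where vs: "max_induced_subseq vs A" "\<forall>z\<in>set vs. \<not> x < z"
      "branching (Suc n) vs" by blast
    then obtain C y D where C: "max_induced_subseq (C @ y # D) vs" "\<forall>z\<in>set C. z < y" "branching n C"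
      by auto
    have "y \<le> x" using C(1) vs(2) max_induced_set by fastforce
    then have "separated False C ws" using C(2) 2(2) by (fastforce simp: separated_def)
    moreover have "max_induced_subseq C A"
      by (rule max_induced_trans[OF max_induced_left max_induced_trans[OF C(1) vs(1)]])
    ultimately show ?thesis using 2 C(3) by blast
  qed
qed

lemma uniform_join:
  assumes "max_induced_subseq (A @ x # B) xs" "\<forall>y\<in>set A \<union> set B. y < x"
    and "max_induced_subseq A' A" "max_induced_subseq B' B" "separated d A' B'"
    and "uniform d h A'" "uniform d h B'"
  shows "uniform d (Suc h) xs"
proof -
  have "max_induced_subseq (A' @ x # B') (A @ x # B)"
    using assms by (intro max_induced_join) (auto intro: less_imp_le)
  then have "max_induced_subseq (A' @ x # B') xs" using assms(1) max_induced_trans by blast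
  moreover have "\<forall>y\<in>set A' \<union> set B'. y < x" using assms(2-4) max_induced_set by blast
  ultimately show ?thesis using assms(5-7) by auto
qed

text \<open>The induction for two-colour Ramsey numbers, with the direction of separation at the
  root as colour. In direction \<open>True\<close> either some subtree already contains the
  \<open>False\<close> tree of height \<open>b\<close>, or both contain \<open>True\<close> trees of
  height \<open>a'\<close> and the root adds a level; direction \<open>False\<close> is
  symmetric.\<close>

lemma uniform_ramsey:
  "\<exists>h. \<forall>xs :: 'a::linorder list. branching h xs \<longrightarrow> uniform True a xs \<or> uniform False b xs"
proof (induction "a + b" arbitrary: a b)
  case 0
  then show ?case by auto
next
  case (Suc n)
  show ?case
  proof (cases "a = 0 \<or> b = 0")
    case True
    then show ?thesis by auto
  next
    case False
    then obtain a' b' where ab: "a = Suc a'" "b = Suc b'" by (metis not0_implies_Suc)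
    obtain h1 h2 where
      h1: "\<And>xs :: 'a list. branching h1 xs \<Longrightarrow> uniform True a' xs \<or> uniform False b xs" and
      h2: "\<And>xs :: 'a list. branching h2 xs \<Longrightarrow> uniform True a xs \<or> uniform False b' xs"
      using Suc.hyps(1)[of a' b] Suc.hyps(1)[of a b'] Suc.hyps(2) ab by auto
    define k where "k = max h1 h2"
    have "uniform True a xs \<or> uniform False b xs"
      \<comment> \<open>One level for the root, and \<open>2 * k + 1\<close> so that height
        \<open>k\<close> survives \<open>branching_separate\<close>.\<close>
      if "branching (Suc (2 * k + 1)) xs" for xs :: "'a list"
    proof -
      from that obtain A x B where AB: "max_induced_subseq (A @ x # B) xs"
        "\<forall>y\<in>set A \<union> set B. y < x" "branching (2 * k + 1) A" "branching (2 * k + 1) B"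
        unfolding branching.simps by blast
      from branching_separate[OF AB(3,4)] obtain d A' B' where
        AB': "max_induced_subseq A' A" "max_induced_subseq B' B" "separated d A' B'"
        "branching k A'" "branching k B'" by blast
      have ind: "max_induced_subseq A' xs" "max_induced_subseq B' xs"
        using max_induced_trans[OF AB'(1) max_induced_trans[OF max_induced_left AB(1)]]
          max_induced_trans[OF AB'(2) max_induced_trans[OF max_induced_right AB(1)]] by auto
      have br: "branching h1 A'" "branching h1 B'" "branching h2 A'" "branching h2 B'"
        using AB'(4,5) by (auto intro: branching_antimono simp: k_def)
      note join = uniform_join[OF AB(1,2) AB'(1-3)]
      show ?thesis
      proof (cases d)
        case True
        then have "uniform True a xs" if "uniform True a' A'" "uniform True a' B'"
          using join[of a'] that ab(1) by simp
        then show ?thesis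
          using h1[OF br(1)] h1[OF br(2)] uniform_mono[OF _ ind(1)] uniform_mono[OF _ ind(2)]
          by blast
      next
        case False
        then have "uniform False b xs" if "uniform False b' A'" "uniform False b' B'"
          using join[of b'] that ab(2) by simp
        then show ?thesis
          using h2[OF br(3)] h2[OF br(4)] uniform_mono[OF _ ind(1)] uniform_mono[OF _ ind(2)]
          by blast
      qed
    qed
    then show ?thesis by blast
  qed
qed

section \<open>Patterns with a peak\<close>

text \<open>By trichotomy, strict comparisons in both directions determine equality, so one
  condition on all pairs of positions is enough.\<close>

lemma same_pattern_iff:
  "same_pattern xs ys \<longleftrightarrow> length xs = length ys \<and>
    (\<forall>i < length xs. \<forall>j < length xs. xs ! i < xs ! j \<longleftrightarrow> ys ! i < ys ! j)" (is "?L \<longleftrightarrow> ?R")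
proof
  assume ?L
  then have "xs ! i < xs ! j \<longleftrightarrow> ys ! i < ys ! j" if "i < length xs" "j < length xs" for i j
    using that by (cases i j rule: linorder_cases) (auto simp: same_pattern_def)
  with \<open>?L\<close> show ?R by (auto simp: same_pattern_def)
next
  assume R: ?R
  show ?L
    unfolding same_pattern_def
  proof (intro conjI allI impI)
    fix i j assume "i < j \<and> j < length xs"
    then have "xs ! i < xs ! j \<longleftrightarrow> ys ! i < ys ! j" "xs ! j < xs ! i \<longleftrightarrow> ys ! j < ys ! i"
      using R by auto
    then show "xs ! i < xs ! j \<longleftrightarrow> ys ! i < ys ! j" "xs ! j < xs ! i \<longleftrightarrow> ys ! j < ys ! i"
      "xs ! i = xs ! j \<longleftrightarrow> ys ! i = ys ! j"
      using less_linear[of "xs ! i" "xs ! j"] less_linear[of "ys ! i" "ys ! j"] by auto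
  qed (use R in simp)
qed

lemma same_pattern_sym: "same_pattern xs ys \<Longrightarrow> same_pattern ys xs"
  by (auto simp: same_pattern_iff)

lemma same_pattern_trans: "same_pattern xs ys \<Longrightarrow> same_pattern ys zs \<Longrightarrow> same_pattern xs zs"
  by (auto simp: same_pattern_iff)

lemma same_pattern_distinct:
  assumes "same_pattern xs ys" "distinct ys"
  shows "distinct xs"
  unfolding distinct_conv_nth
proof (intro allI impI)
  fix i j assume ij: "i < length xs" "j < length xs" "i \<noteq> j"
  then have "ys ! i \<noteq> ys ! j" using assms by (auto simp: same_pattern_iff nth_eq_iff_index_eq)
  then show "xs ! i \<noteq> xs ! j" using ij assms by (auto simp: same_pattern_iff neq_iff)
qed

text \<open>Comparisons inside a block are inherited, those with the peak are fixed by its being the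
  maximum, and those across are fixed by \<open>d\<close>.\<close>

lemma same_pattern_join:
  assumes "same_pattern A A'" "same_pattern B B'" "separated d A B" "separated d A' B'"
    and "\<forall>y\<in>set A \<union> set B. y < x" "\<forall>y\<in>set A' \<union> set B'. y < x'"
  shows "same_pattern (A @ x # B) (A' @ x' # B')"
proof -
  have len: "length A = length A'" "length B = length B'"
    using assms(1,2) by (auto simp: same_pattern_iff)
  define S S' n where "S = A @ x # B" and "S' = A' @ x' # B'" and "n = length A"
  have nth: "S ! i = A ! i" "S' ! i = A' ! i" if "i < n" for i
    using that len by (auto simp: S_def S'_def n_def nth_append)
  have nth': "S ! n = x" "S' ! n = x'" "S ! Suc (n + k) = B ! k" "S' ! Suc (n + k) = B' ! k" for k
    using len by (auto simp: S_def S'_def n_def nth_append)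
  have A: "A ! i < x" "A' ! i < x'" "\<not> x < A ! i" "\<not> x' < A' ! i" if "i < n" for i
    using that assms(5,6) len by (auto simp: n_def not_less intro: less_imp_le)
  have B: "B ! i < x" "B' ! i < x'" "\<not> x < B ! i" "\<not> x' < B' ! i" if "i < length B" for i
    using that assms(5,6) len by (auto simp: not_less intro: less_imp_le)
  have AB: "A ! i < B ! k \<longleftrightarrow> \<not> d" "A' ! i < B' ! k \<longleftrightarrow> \<not> d" "B ! k < A ! i \<longleftrightarrow> d" "B' ! k < A' ! i \<longleftrightarrow> d"
    if "i < n" "k < length B" for i k
  proof -
    have "A ! i \<in> set A" "B ! k \<in> set B" "A' ! i \<in> set A'" "B' ! k \<in> set B'"
      using that len by (auto simp: n_def)
    then have "if d then B ! k < A ! i else A ! i < B ! k"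
      "if d then B' ! k < A' ! i else A' ! i < B' ! k"
      using assms(3,4) by (auto simp: separated_def)
    then show "A ! i < B ! k \<longleftrightarrow> \<not> d" "A' ! i < B' ! k \<longleftrightarrow> \<not> d"
      "B ! k < A ! i \<longleftrightarrow> d" "B' ! k < A' ! i \<longleftrightarrow> d"
      by (auto split: if_splits)
  qed
  have ind: "A ! i < A ! k \<longleftrightarrow> A' ! i < A' ! k" if "i < n" "k < n" for i k
    using that assms(1) by (auto simp: same_pattern_iff n_def)
  have ind': "B ! i < B ! k \<longleftrightarrow> B' ! i < B' ! k" if "i < length B" "k < length B" for i k
    using that assms(2) by (auto simp: same_pattern_iff)
  have pos: "i < n \<or> i = n \<or> (\<exists>k. i = Suc (n + k) \<and> k < length B)" if "i < length S" for i
    using that less_imp_Suc_add[of n i] by (fastforce simp: S_def n_def)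
  have "S ! i < S ! j \<longleftrightarrow> S' ! i < S' ! j" if ij: "i < length S" "j < length S" for i j
    using pos[OF ij(1)] pos[OF ij(2)]
    by (elim disjE exE conjE) (simp_all add: nth nth' A B AB ind ind')
  then show ?thesis using len by (simp add: same_pattern_iff S_def S'_def)
qed

text \<open>\<open>True\<close> stands for \<open>132\<close> and \<open>False\<close> for its reversal \<open>231\<close>.\<close>

definition peak_word :: "bool \<Rightarrow> nat list" where
  "peak_word d = (if d then [1, 3, 2] else [2, 3, 1])"

definition peak_avoiding :: "bool \<Rightarrow> 'a::linorder list \<Rightarrow> bool" where
  "peak_avoiding d xs \<longleftrightarrow> (\<forall>i j k. i < j \<and> j < k \<and> k < length xs \<longrightarrow>
     \<not> (xs ! i < xs ! j \<and> xs ! k < xs ! j \<and> (if d then xs ! i < xs ! k else xs ! k < xs ! i)))"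

lemma same_pattern_peak_word_iff:
  "same_pattern (ys :: 'a::linorder list) (peak_word d) \<longleftrightarrow>
    (\<exists>a m b. ys = [a, m, b] \<and> a < m \<and> b < m \<and> (if d then a < b else b < a))"
proof -
  have "same_pattern [a, m, b] (peak_word d) \<longleftrightarrow> a < m \<and> b < m \<and> (if d then a < b else b < a)"
    for a m b :: 'a
    unfolding same_pattern_iff
    by (cases d) (simp_all add: peak_word_def numeral_3_eq_3 All_less_Suc, auto)
  moreover have "\<exists>a m b. ys = [a, m, b]" if "same_pattern ys (peak_word d)"
    using that by (cases d) (auto simp: same_pattern_iff peak_word_def length_Suc_conv)
  ultimately show ?thesis by blast
qed

lemma subseq_Cons_left_iff:
  "subseq (x # ys) xs \<longleftrightarrow> (\<exists>i < length xs. xs ! i = x \<and> subseq ys (drop (Suc i) xs))" (is "?L \<longleftrightarrow> ?R")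
proof
  assume ?L
  then obtain us v vs where "xs = us @ v # vs" "x = v" "subseq ys vs" by (auto dest: list_emb_ConsD)
  then show ?R by (intro exI[of _ "length us"]) auto
next
  assume ?R
  then obtain i where "i < length xs" "xs ! i = x" "subseq ys (drop (Suc i) xs)" by blast
  then show ?L by (metis id_take_nth_drop list_emb_append2 subseq_Cons2)
qed

lemma seq_contains_peak_iff:
  "seq_contains xs (pattern_of_word (peak_word d)) \<longleftrightarrow> \<not> peak_avoiding d xs" (is "?L \<longleftrightarrow> ?R")
proof
  assume ?L
  then obtain a m b where amb: "subseq [a, m, b] xs" "a < m" "b < m" "if d then a < b else b < a"
    by (auto simp: seq_contains_def pattern_of_word_def same_pattern_peak_word_iff)
  from amb(1) obtain i j k where "i < length xs" "xs ! i = a" "j < length (drop (Suc i) xs)"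
    "drop (Suc i) xs ! j = m" "k < length (drop (Suc j) (drop (Suc i) xs))"
    "drop (Suc j) (drop (Suc i) xs) ! k = b"
    unfolding subseq_Cons_left_iff by blast
  then have "i < length xs" "xs ! i = a" "Suc i + j < length xs" "xs ! (Suc i + j) = m"
    "Suc i + (Suc j + k) < length xs" "xs ! (Suc i + (Suc j + k)) = b"
    by (auto simp: ac_simps)
  with amb show ?R unfolding peak_avoiding_def not_all not_imp not_not
    by (intro exI[of _ i] exI[of _ "Suc i + j"] exI[of _ "Suc i + (Suc j + k)"]) auto
next
  assume ?R
  then obtain i j k where ijk: "i < j" "j < k" "k < length xs" "xs ! i < xs ! j" "xs ! k < xs ! j"
    "if d then xs ! i < xs ! k else xs ! k < xs ! i" by (auto simp: peak_avoiding_def)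
  then have "subseq [xs ! i, xs ! j, xs ! k] xs"
    unfolding subseq_Cons_left_iff
    by (intro exI[of _ i] conjI exI[of _ "j - Suc i"] exI[of _ "k - Suc j"]) auto
  with ijk show ?L unfolding seq_contains_def pattern_of_word_def
    by (intro exI[of _ "[xs ! i, xs ! j, xs ! k]"]) (simp add: same_pattern_peak_word_iff)
qed

lemma peak_avoiding_subseq: "peak_avoiding d xs \<Longrightarrow> subseq ys xs \<Longrightarrow> peak_avoiding d ys"
  using seq_contains_peak_iff unfolding seq_contains_def by (metis subseq_order.order_trans)

lemma peak_avoiding_same_pattern:
  assumes "same_pattern xs ys" "peak_avoiding d ys"
  shows "peak_avoiding d xs"
proof -
  have len: "length xs = length ys" and
    less: "\<And>i j. i < length ys \<Longrightarrow> j < length ys \<Longrightarrow> xs ! i < xs ! j \<longleftrightarrow> ys ! i < ys ! j"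
    using assms(1) by (auto simp: same_pattern_iff)
  show ?thesis
    unfolding peak_avoiding_def
  proof (intro allI impI)
    fix i j k assume "i < j \<and> j < k \<and> k < length xs"
    then show "\<not> (xs ! i < xs ! j \<and> xs ! k < xs ! j \<and>
        (if d then xs ! i < xs ! k else xs ! k < xs ! i))"
      using assms(2)[unfolded peak_avoiding_def, rule_format, of i j k] len less by auto
  qed
qed

text \<open>In a forbidden triple the maximum \<open>x\<close> cannot be an outer entry. So the
  outer entries lie in different blocks, against \<open>separated\<close>, or the whole triple lies
  inside one block.\<close>

lemma peak_avoiding_join:
  assumes "peak_avoiding d A" "peak_avoiding d B" "separated d A B" "\<forall>y\<in>set A \<union> set B. y < x"
  shows "peak_avoiding d (A @ x # B)"
  unfolding peak_avoiding_def
proof (intro allI impI notI)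
  fix i j k
  let ?S = "A @ x # B" and ?n = "length A"
  assume ijk: "i < j \<and> j < k \<and> k < length ?S"
    and peak: "?S ! i < ?S ! j \<and> ?S ! k < ?S ! j \<and> (if d then ?S ! i < ?S ! k else ?S ! k < ?S ! i)"
  have "?S ! j \<in> set ?S" using ijk by (intro nth_mem) auto
  then have "?S ! j \<le> x" using assms(4) by (auto intro: less_imp_le)
  then have "?S ! i \<noteq> x" "?S ! k \<noteq> x" using peak by auto
  then have "i \<noteq> ?n" "k \<noteq> ?n" by auto
  then consider "k < ?n" | "i < ?n" "?n < k" | "?n < i" using ijk by linarith
  then show False
  proof cases
    case 1
    then have "?S ! i = A ! i" "?S ! j = A ! j" "?S ! k = A ! k" using ijk by (auto simp: nth_append)
    then show False using assms(1) ijk peak 1 unfolding peak_avoiding_def by metis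
  next
    case 2
    then have "?S ! i \<in> set A" "?S ! k \<in> set B" using ijk by (auto simp: nth_append nth_Cons')
    then show False using assms(3) peak by (fastforce simp: separated_def split: if_splits)
  next
    case 3
    define i' j' k' where "i' = i - Suc ?n" and "j' = j - Suc ?n" and "k' = k - Suc ?n"
    then have "i = Suc ?n + i'" "j = Suc ?n + j'" "k = Suc ?n + k'" using 3 ijk by auto
    then have "i' < j'" "j' < k'" "k' < length B" "?S ! i = B ! i'" "?S ! j = B ! j'" "?S ! k = B ! k'"
      using ijk by (auto simp: nth_append)
    then show False using assms(2) peak unfolding peak_avoiding_def by metis
  qed
qed

lemma distinct_split_Max:
  fixes xs :: "'a::linorder list"
  assumes "distinct xs" "xs \<noteq> []"
  obtains A x B where "xs = A @ x # B" "\<forall>y\<in>set A \<union> set B. y < x"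
proof -
  have "Max (set xs) \<in> set xs" using assms(2) by simp
  then obtain A B where xs: "xs = A @ Max (set xs) # B" by (meson split_list)
  have "y < Max (set xs)" if "y \<in> set A \<union> set B" for y
  proof -
    have "y \<noteq> Max (set xs)" using assms(1) xs that
      by (metis Un_iff distinct.simps(2) distinct_append insert_disjoint(1) list.simps(15) disjoint_iff list.set_intros(1))
    moreover have "y \<in> set xs" using that xs by (metis Un_iff set_append list.set_intros(2))
    ultimately show ?thesis by (simp add: order.not_eq_order_implies_strict)
  qed
  then show thesis using that xs by blast
qed

text \<open>Avoidance separates the two sides of the maximum of \<open>p\<close> in the same
  direction \<open>d\<close> as the subtrees of the root, so the sides can be found recursively in
  those subtrees. Each level uses up one entry of \<open>p\<close>, whence
  \<open>length p \<le> h\<close>.\<close>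

lemma uniform_contains:
  assumes "distinct p" "peak_avoiding d p" "length p \<le> h" "uniform d h xs"
  shows "\<exists>ys. max_induced_subseq ys xs \<and> same_pattern ys p"
  using assms
proof (induction h arbitrary: p xs)
  case 0
  then show ?case using max_induced_Nil by (intro exI[of _ "[]"]) (auto simp: same_pattern_iff)
next
  case (Suc h)
  show ?case
  proof (cases "p = []")
    case True
    then show ?thesis using max_induced_Nil by (intro exI[of _ "[]"]) (auto simp: same_pattern_iff)
  next
    case False
    obtain L m R where p: "p = L @ m # R" "\<forall>y\<in>set L \<union> set R. y < m"
      using distinct_split_Max Suc.prems(1) False by metis
    have sep: "separated d L R"
      unfolding separated_def
    proof (intro ballI)
      fix a b assume ab: "a \<in> set L" "b \<in> set R"
      then have "subseq ([a] @ [m] @ [b]) (L @ [m] @ R)"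
        by (intro list_emb_append_mono) (auto simp: subseq_singleton_left)
      then have "subseq [a, m, b] p" using p by simp
      then have "peak_avoiding d [a, m, b]" using Suc.prems(2) peak_avoiding_subseq by blast
      then have "\<not> same_pattern [a, m, b] (peak_word d)"
        using seq_contains_peak_iff unfolding seq_contains_def pattern_of_word_def by blast
      moreover have "a \<noteq> b" using Suc.prems(1) p ab by auto
      ultimately show "if d then b < a else a < b"
        using p ab by (auto simp: same_pattern_peak_word_iff)
    qed
    have "subseq L p" "subseq R p"
      unfolding p(1) by (simp_all add: max_induced_left max_induced_right max_induced_subseq_subseq)
    then have pa: "peak_avoiding d L" "peak_avoiding d R"
      using Suc.prems(2) peak_avoiding_subseq by blast+
    from Suc.prems(4) obtain A x B where AB: "max_induced_subseq (A @ x # B) xs"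
      "\<forall>y\<in>set A \<union> set B. y < x" "separated d A B" "uniform d h A" "uniform d h B" by auto
    obtain yA where yA: "max_induced_subseq yA A" "same_pattern yA L"
      using Suc.IH[OF _ pa(1) _ AB(4)] Suc.prems(1,3) p by auto
    obtain yB where yB: "max_induced_subseq yB B" "same_pattern yB R"
      using Suc.IH[OF _ pa(2) _ AB(5)] Suc.prems(1,3) p by auto
    have sub: "set yA \<subseteq> set A" "set yB \<subseteq> set B" using yA(1) yB(1) max_induced_set by auto
    have "max_induced_subseq (yA @ x # yB) (A @ x # B)"
      using yA yB AB(2) by (intro max_induced_join) (auto intro: less_imp_le)
    moreover have "same_pattern (yA @ x # yB) p"
      unfolding p(1) by (rule same_pattern_join[OF yA(2) yB(2) _ sep])
        (use sub AB p in \<open>auto simp: separated_def subset_iff\<close>)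
    ultimately show ?thesis using max_induced_trans[OF _ AB(1)] by blast
  qed
qed

section \<open>Permutation patterns through their representatives\<close>

lemma pattern_mem_iff:
  assumes "P \<in> patterns" "xs \<in> P"
  shows "ys \<in> P \<longleftrightarrow> same_pattern xs ys"
proof -
  obtain zs where zs: "zs \<noteq> []" "P = same_pattern_rel `` {zs}"
    using assms(1) by (auto simp: patterns_def elim: quotientE)
  then have "same_pattern zs xs" "xs \<noteq> []" using assms(2) by (auto simp: same_pattern_rel_def)
  then show ?thesis using zs same_pattern_trans same_pattern_sym
    by (auto simp: same_pattern_rel_def) (auto simp: same_pattern_iff)
qed

lemma permutation_pattern_iff:
  assumes "P \<in> patterns"
  shows "permutation_pattern P \<longleftrightarrow> (\<exists>xs\<in>P. distinct xs)"
proof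
  assume "\<exists>xs\<in>P. distinct xs"
  then obtain xs where xs: "xs \<in> P" "distinct xs" by blast
  \<comment> \<open>The rank of an entry, counted from 1; replacing entries by ranks gives the
    required permutation.\<close>
  define r where "r x = card {y\<in>set xs. y \<le> x}" for x
  have less: "r x < r y" if "x < y" "y \<in> set xs" for x y
  proof -
    have "{z\<in>set xs. z \<le> x} \<subseteq> {z\<in>set xs. z \<le> y}" "y \<in> {z\<in>set xs. z \<le> y} - {z\<in>set xs. z \<le> x}"
      using that by auto
    then show ?thesis unfolding r_def by (intro psubset_card_mono) auto
  qed
  then have less_iff: "r x < r y \<longleftrightarrow> x < y" if "x \<in> set xs" "y \<in> set xs" for x y
    using that by (metis linorder_less_linear order.asym)
  have inj: "inj_on r (set xs)" using less by (intro linorder_inj_onI') (auto simp: less_le)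
  have "r ` set xs \<subseteq> {1..length xs}"
  proof
    fix n assume "n \<in> r ` set xs"
    then obtain x where x: "x \<in> set xs" "n = r x" by blast
    then have "{y\<in>set xs. y \<le> x} \<noteq> {}" by auto
    then have "r x \<noteq> 0" by (simp add: r_def)
    moreover have "r x \<le> card (set xs)" unfolding r_def by (intro card_mono) auto
    ultimately show "n \<in> {1..length xs}" using x xs(2) by (simp add: distinct_card)
  qed
  moreover have "card (r ` set xs) = card {1..length xs}"
    using inj xs(2) by (simp add: card_image distinct_card)
  ultimately have "set (map r xs) = {1..length xs}" by (simp add: card_subset_eq)
  moreover have "distinct (map r xs)" using inj xs(2) by (simp add: distinct_map)
  moreover have "same_pattern xs (map r xs)" using less_iff by (auto simp: same_pattern_iff)
  ultimately show "permutation_pattern P" using assms xs(1) unfolding permutation_pattern_def by blast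
qed (use same_pattern_distinct in \<open>auto simp: permutation_pattern_def\<close>)

text \<open>Distinctness and avoidance are invariant under \<open>same_pattern\<close>, so a single
  representative decides both.\<close>

lemma peak_avoiding_permutation_pattern_iff:
  assumes "P \<in> patterns"
  shows "permutation_pattern P \<and> pattern_avoids P (pattern_of_word (peak_word d)) \<longleftrightarrow>
    (\<exists>xs\<in>P. distinct xs \<and> peak_avoiding d xs)" (is "?L \<longleftrightarrow> ?R")
proof
  assume ?L
  then show ?R using permutation_pattern_iff[OF assms] seq_contains_peak_iff
    unfolding pattern_avoids_def by blast
next
  assume ?R
  then obtain xs where xs: "xs \<in> P" "distinct xs" "peak_avoiding d xs" by blast
  then have "peak_avoiding d ys" if "ys \<in> P" for ys
    using that pattern_mem_iff[OF assms] peak_avoiding_same_pattern by blast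
  then show ?L using xs permutation_pattern_iff[OF assms] seq_contains_peak_iff
    unfolding pattern_avoids_def by blast
qed

lemma max_induced_mem_pattern:
  assumes "P \<in> patterns" "distinct p" "p \<in> P" "peak_avoiding d p" "uniform d (length p) xs"
  shows "\<exists>ys\<in>P. max_induced_subseq ys xs"
proof -
  obtain ys where "max_induced_subseq ys xs" "same_pattern ys p"
    using uniform_contains[OF assms(2,4) order.refl assms(5)] by blast
  then show ?thesis using pattern_mem_iff[OF assms(1,3)] same_pattern_sym by blast
qed

section \<open>Complete binary trees\<close>

text \<open>\<open>zs\<close> only supplies values: the largest becomes the root, and the lower and
  upper halves of the rest label its subtrees. By \<open>max_induced_split\<close>, each level
  lengthens a monotonic max-induced subsequence by at most one.\<close>

lemma complete_sequence:
  fixes zs :: "'a::linorder list"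
  assumes "sorted_wrt (<) zs" "length zs = 2 ^ n - 1"
  shows "\<exists>S. set S = set zs \<and> distinct S \<and> peak_avoiding d S \<and>
    (\<forall>ys. max_induced_subseq ys S \<longrightarrow> monotonic ys \<longrightarrow> length ys \<le> n)"
  using assms
proof (induction n arbitrary: zs)
  case 0
  then show ?case by (auto simp: peak_avoiding_def dest: max_induced_set)
next
  case (Suc n)
  define k :: nat where "k = 2 ^ n - 1"
  have len: "length zs = k + k + 1"
  proof -
    have "(2::nat) ^ n \<ge> 1" by simp
    then show ?thesis using Suc.prems(2) unfolding k_def power_Suc by linarith
  qed
  define U V m where "U = take k zs" and "V = take k (drop k zs)" and "m = last zs"
  have zs: "zs = U @ V @ [m]"
  proof -
    have "butlast zs = U @ V"
      using len by (simp add: U_def V_def butlast_conv_take flip: take_add)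
    moreover have "zs \<noteq> []" using len by auto
    ultimately show ?thesis unfolding m_def by (metis append_assoc append_butlast_last_id)
  qed
  have UV: "sorted_wrt (<) U" "sorted_wrt (<) V" "\<forall>u\<in>set U. \<forall>v\<in>set V. u < v"
    "\<forall>u\<in>set U \<union> set V. u < m"
    using Suc.prems(1) unfolding zs by (auto simp: sorted_wrt_append)
  have lenUV: "length U = k" "length V = k" using len by (auto simp: U_def V_def)
  obtain SU where SU: "set SU = set U" "distinct SU" "peak_avoiding d SU"
    "\<And>ys. max_induced_subseq ys SU \<Longrightarrow> monotonic ys \<Longrightarrow> length ys \<le> n"
    using Suc.IH[OF UV(1)] lenUV k_def by auto
  obtain SV where SV: "set SV = set V" "distinct SV" "peak_avoiding d SV"
    "\<And>ys. max_induced_subseq ys SV \<Longrightarrow> monotonic ys \<Longrightarrow> length ys \<le> n"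
    using Suc.IH[OF UV(2)] lenUV k_def by auto
  \<comment> \<open>The upper half goes to the left for 132 and to the right for 231.\<close>
  define A B where "A = (if d then SV else SU)" and "B = (if d then SU else SV)"
  have AB: "set A \<union> set B = set U \<union> set V" "distinct A" "distinct B" "peak_avoiding d A"
      "peak_avoiding d B" "separated d A B" "\<forall>y\<in>set A \<union> set B. y < m"
    and A: "\<And>ys. max_induced_subseq ys A \<Longrightarrow> monotonic ys \<Longrightarrow> length ys \<le> n"
    and B: "\<And>ys. max_induced_subseq ys B \<Longrightarrow> monotonic ys \<Longrightarrow> length ys \<le> n"
    using SU SV UV by (cases d; simp add: A_def B_def separated_def Un_commute)+
  have "set A \<inter> set B = {}" using AB(6) by (fastforce simp: separated_def split: if_splits)
  then have "distinct (A @ m # B)" using AB by auto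
  moreover have "set (A @ m # B) = set zs" using AB(1) zs by auto
  moreover have "length ys \<le> Suc n" if ys: "max_induced_subseq ys (A @ m # B)" "monotonic ys" for ys
  proof -
    consider "max_induced_subseq ys A" | "max_induced_subseq ys B"
      | yA yB where "ys = yA @ m # yB" "max_induced_subseq yA A" "max_induced_subseq yB B"
      using max_induced_split[OF ys(1)] AB(7) by blast
    then show ?thesis
    proof cases
      case 3
      have less: "\<forall>y\<in>set yA \<union> set yB. y < m" using 3 max_induced_set AB(7) by blast
      have mono: "monotonic yA" "monotonic yB"
        using ys(2) 3(1) by (auto simp: monotonic_def sorted_wrt_append)
      \<comment> \<open>With smaller entries on both sides of \<open>m\<close>, the subsequence
        would rise and then fall.\<close>
      have "yA = [] \<or> yB = []"
        using ys(2) less unfolding 3(1) monotonic_def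
        by (cases yA; cases yB) (auto simp: sorted_wrt_append)
      then show ?thesis using A[OF 3(2) mono(1)] B[OF 3(3) mono(2)] 3(1) by auto
    qed (use A B ys(2) le_SucI in blast)+
  qed
  ultimately show ?case using peak_avoiding_join[OF AB(4-7)] by blast
qed

section \<open>Necessity and sufficiency\<close>

lemma max_induced_EH_imp:
  fixes F :: "'a::linorder list set set"
  assumes inf: "infinite (UNIV :: 'a set)" and F: "F \<subseteq> patterns" and EH: "max_induced_EH F"
  shows "\<exists>P\<in>F. permutation_pattern P \<and> pattern_avoids P (pattern_of_word (peak_word d))"
proof (rule ccontr)
  assume "\<not> ?thesis"
  then have no: "\<not> (distinct xs \<and> peak_avoiding d xs)" if "P \<in> F" "xs \<in> P" for P xs
    using that F peak_avoiding_permutation_pattern_iff by blast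
  obtain c :: real where c: "c > 0" and
    EH: "\<And>S :: 'a list. (\<forall>ys. max_induced_subseq ys S \<longrightarrow> (\<forall>P\<in>F. ys \<notin> P)) \<Longrightarrow>
      \<exists>ys. max_induced_subseq ys S \<and> monotonic ys \<and> real (length ys) \<ge> real (length S) powr c"
    using EH unfolding max_induced_EH_def by metis
  \<comment> \<open>Subsequences of the complete sequence are distinct and peak-avoiding, hence in
    no member of \<open>F\<close>, so the property applies to it. The resulting inequality fails for
    large \<open>n\<close> because \<open>c\<close> is positive.\<close>
  have bound: "real (2 ^ n - 1) powr c \<le> real n" for n
  proof -
    obtain X :: "'a set" where X: "finite X" "card X = 2 ^ n - 1"
      using infinite_arbitrarily_large[OF inf] by metis
    obtain S where S: "set S = X" "distinct S" "peak_avoiding d S"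
      and mono: "\<And>ys. max_induced_subseq ys S \<Longrightarrow> monotonic ys \<Longrightarrow> length ys \<le> n"
      using complete_sequence[of "sorted_list_of_set X" n d] X by auto
    have "\<forall>ys. max_induced_subseq ys S \<longrightarrow> (\<forall>P\<in>F. ys \<notin> P)"
      using no S(2,3) max_induced_subseq_subseq peak_avoiding_subseq
      by (metis distinct_nthsI subseq_conv_nths)
    from EH[OF this] obtain ys where ys: "max_induced_subseq ys S" "monotonic ys"
      "real (length ys) \<ge> real (length S) powr c" by blast
    have "length S = 2 ^ n - 1" using S X distinct_card by metis
    then show ?thesis using ys mono[OF ys(1,2)] by (metis of_nat_le_iff order_trans)
  qed
  have "eventually (\<lambda>n::nat. real n < (2 ^ n - 1) powr c) at_top"
    using c by real_asymp
  then obtain n :: nat where "real n < (2 ^ n - 1) powr c"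
    by (auto simp: eventually_at_top_linorder)
  moreover have "real (2 ^ n - 1) = 2 ^ n - 1" by (simp add: of_nat_diff)
  ultimately show False using bound[of n] by simp
qed

text \<open>\<open>uniform_ramsey\<close> gives a height \<open>h\<close> at which a copy of
  \<open>p\<close> or of \<open>q\<close> is forced. A sequence without them is not
  \<open>branching h\<close>, so its length is polynomially bounded in the largest monotonic length
  \<open>k\<close>.\<close>

lemma max_induced_EH_if:
  fixes F :: "'a::linorder list set set"
  assumes "F \<subseteq> patterns"
    and P: "P \<in> F" "permutation_pattern P" "pattern_avoids P (pattern_of_word (peak_word True))"
    and Q: "Q \<in> F" "permutation_pattern Q" "pattern_avoids Q (pattern_of_word (peak_word False))"
  shows "max_induced_EH F"
proof -
  have pat: "P \<in> patterns" "Q \<in> patterns" using assms by auto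
  obtain p where p: "p \<in> P" "distinct p" "peak_avoiding True p"
    using P pat(1) peak_avoiding_permutation_pattern_iff by blast
  obtain q where q: "q \<in> Q" "distinct q" "peak_avoiding False q"
    using Q pat(2) peak_avoiding_permutation_pattern_iff by blast
  obtain h where h: "\<And>xs :: 'a list. branching h xs \<Longrightarrow> uniform True (length p) xs \<or> uniform False (length q) xs"
    using uniform_ramsey by blast
  \<comment> \<open>For \<open>k \<ge> 2\<close>, \<open>2 * k + 1 \<le> k ^ 3\<close> turns the
    exponent \<open>2 * h\<close> into \<open>6 * h\<close>; the added 1 keeps \<open>e\<close>
    positive when \<open>h\<close> is 0.\<close>
  define e where "e = 6 * h + 1"
  then have "e > 0" by simp
  show ?thesis
    unfolding max_induced_EH_def
  proof (intro exI[of _ "1 / real e"] conjI allI impI)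
    show "1 / real e > 0" using \<open>e > 0\<close> by simp
    fix S :: "'a list"
    assume no: "\<forall>ys. max_induced_subseq ys S \<longrightarrow> (\<forall>P\<in>F. ys \<notin> P)"
    have nb: "\<not> branching h S"
    proof
      assume "branching h S"
      from h[OF this] show False
        using max_induced_mem_pattern[OF pat(1) p(2,1,3)] max_induced_mem_pattern[OF pat(2) q(2,1,3)]
          no P(1) Q(1) by blast
    qed
    define M where "M = {length ys | ys. max_induced_subseq ys S \<and> monotonic ys}"
    have "M \<subseteq> {..length S}"
      by (auto simp: M_def dest!: max_induced_subseq_subseq list_emb_length)
    then have M: "finite M" by (rule finite_subset) simp
    have "0 \<in> M" using max_induced_Nil by (force simp: M_def monotonic_def)
    define k where "k = Max M"
    have "k \<in> M" using M \<open>0 \<in> M\<close> Max_in unfolding k_def by blast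
    then obtain ys where ys: "max_induced_subseq ys S" "monotonic ys" "length ys = k"
      by (auto simp: M_def)
    have le_k: "length zs \<le> k" if "max_induced_subseq zs S" "monotonic zs" for zs
      using that M by (auto simp: M_def k_def intro!: Max_ge)
    have less: "length S < (k + k + 1) ^ (2 * h)"
      using nb by (rule length_less_of_not_branching) (auto intro!: le_k simp: monotonic_def)
    have "length S \<le> k ^ e"
    proof (cases S)
      case (Cons x S')
      show ?thesis
      proof (cases S')
        case Nil
        then have "1 \<le> k" using le_k[OF max_induced_refl] Cons by (simp add: monotonic_def)
        then show ?thesis using Nil Cons by simp
      next
        case (Cons y S'')
        have "max_path x [x, y] (x # y # S'')" by (intro max_path.intros)
        then have "max_induced_subseq [x, y] S"
          using \<open>S = x # S'\<close> Cons max_induced_iff_max_path by blast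
        \<comment> \<open>Two adjacent entries always form a monotonic max-induced
          subsequence.\<close>
        then have k: "2 \<le> k" using le_k[of "[x, y]"] linear[of x y] by (auto simp: monotonic_def)
        have "k + k + 1 \<le> 4 * k" using k by simp
        also have "\<dots> \<le> k ^ 2 * k" using power_mono[OF k, of 2] by (intro mult_right_mono) auto
        also have "\<dots> = k ^ 3" by (simp add: power3_eq_cube power2_eq_square)
        finally have "(k + k + 1) ^ (2 * h) \<le> (k ^ 3) ^ (2 * h)" by (rule power_mono) simp
        also have "\<dots> = k ^ (6 * h)" by (simp flip: power_mult)
        also have "\<dots> \<le> k ^ e" using k by (intro power_increasing) (auto simp: e_def)
        finally show ?thesis using less by simp
      qed
    qed simp
    then have "real (length S) powr (1 / real e) \<le> (real k ^ e) powr (1 / real e)"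
      by (intro powr_mono2) (auto simp flip: of_nat_power)
    also have "\<dots> = real k"
      using \<open>e > 0\<close> by (cases "k = 0") (simp_all add: powr_powr flip: powr_realpow)
    finally show "\<exists>ys. max_induced_subseq ys S \<and> monotonic ys \<and>
        real (length ys) \<ge> real (length S) powr (1 / real e)"
      using ys by blast
  qed
qed

theorem theorem2p2:
  fixes F :: "'a::linorder list set set"
  assumes "infinite (UNIV :: 'a set)"
    and "F \<subseteq> patterns" and "finite F"
  shows "max_induced_EH F \<longleftrightarrow>
    (\<exists>P\<in>F. permutation_pattern P \<and> pattern_avoids P (pattern_of_word [1, 3, 2])) \<and>
    (\<exists>Q\<in>F. permutation_pattern Q \<and> pattern_avoids Q (pattern_of_word [2, 3, 1]))"
proof -
  have "peak_word True = [1, 3, 2]" "peak_word False = [2, 3, 1]" by (simp_all add: peak_word_def)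
  then show ?thesis
    using max_induced_EH_imp[OF assms(1,2), of True] max_induced_EH_imp[OF assms(1,2), of False]
      max_induced_EH_if[OF assms(2)] by metis
qed

end
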